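(* Let $q\colon E\to M$ be a submersion in a tangent category $(\mathbb X,\mathbb T)$. There is a bijective correspondence between horizontal connections on $q$ and horizontal connection forms on $q$. Concretely, if $H\colon Fq\to TE$ is a horizontal connection on $q$, then $\psi_H:=\pi_qH\colon TE\to TE$ is a horizontal connection form on $q$. Conversely, if $\psi\colon TE\to TE$ is a horizontal connection form on $q$, then the unique morphism $H_\psi\colon\mathbf q^F\to\mathbf p_E$ of $\mathsf{DB}(E)$ satisfying $\pi_qH_\psi=\psi$ and $z_q^FH_\psi=z_E$ (which exists) is a horizontal connection on $q$.
   Context: Composition is diagrammatic: $fg$ is $f$ followed by $g$; $\langle f,g\rangle$ denotes pairing into a (fibred) product, with projections $\pi_1,\pi_2$. A tangent category $(\mathbb X,\mathbb T)$ is a category $\mathbb X$ with an endofunctor $T$ and natural transformations $p_M\colon TM\to M$, $z_M\colon M\to TM$, $s_M\colon T_2M\to TM$, $l_M\colon TM\to T^2M$, $c_M\colon T^2M\to T^2M$, where the $n$-fold pullback $T_nM$ of $p_M$ along itself exists and is preserved by all $T^m$, such that: $(p_M,z_M,s_M)$ is an additive bundle (a commutative monoid in the category over $M$); $(z_M,l_M)\colon p_M\to Tp_M$ and $(\mathrm{id}_{TM},c_M)\colon Tp_M\to p_{TM}$ are additive bundle morphisms (commutative squares preserving zero and sum); $c_Mc_M=\mathrm{id}$, $l_Mc_M=l_M$, $l_M\,Tl_M=l_M\,l_{TM}$, $Tc_M\,c_{TM}\,Tc_M=c_{TM}\,Tc_M\,c_{TM}$, $l_{TM}\,Tc_M\,c_{TM}=c_M\,Tl_M$;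 and, with $\xi_M=\langle\pi_1l_M,\pi_2z_{TM}\rangle\,Ts_M\colon T_2M\to T^2M$, the square $\xi_M\,Tp_M=\pi_1p_Mz_M$ is a tangent pullback. A tangent pullback is a pullback preserved by $T^m$ for all $m\ge0$. A tangent display map is a morphism $q\colon E\to M$ such that for all $n\ge0$ and all $f\colon N\to T^nM$ the pullback of $T^nq$ along $f$ exists and is a tangent pullback. A differential bundle $\mathbf q\colon E\to M$ consists of $q\colon E\to M$, $z_q\colon M\to E$, $s_q\colon E_2\to E$, $l_q\colon E\to TE$ ($E_n$ the $n$-fold pullback of $q$ along itself, required to exist and be preserved by all $T^m$) such that $(q,z_q,s_q)$ is an additive bundle, $(z_M,l_q)\colon q\to Tq$ and $(z_q,l_q)\colon q\to p_E$ are additive bundle morphisms, $l_ql_E=l_q\,Tl_q$, and with $\xi_q=\langle\pi_1l_q,\pi_2z_E\rangle\,Ts_q\colon E_2\to TE$ the square $\xi_q\,Tq=\pi_1qz_M$ is a tangent pullback. Convention: all differential bundles are assumed display, i.e. $q$ is a tangent display map. A morphism $(f,g)\colon\mathbf q\to\mathbf q'$ (with $qf=gq'$) is linear if $g\,l_{q'}=l_q\,Tg$. $\mathsf{DB}(E)$ is the category of differential bundles over $E$ and linear morphisms over $\mathrm{id}_E$; it has finite biproducts, with zero object the trivial bundle $\mathbf 0_E=(\mathrm{id}_E,\mathrm{id}_E,\mathrm{id}_E,z_E)$. $\mathbf p_E=(p_E,z_E,s_E,l_E)$ is the tangent bundle. For a tangent display map $q\colon E\to M$: the vertical bundle $\mathbf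 q^V\colon Vq\to E$ is given by the tangent pullback $Vq$ of $Tq$ along $z_M$, with projections $\iota_q\colon Vq\to TE$ and $T^Vq\colon Vq\to M$; $q^V=\iota_qp_E$, and its zero $z_q^V$, sum $s^V_q$, lift $l_q^V$ are determined by $z_q^V\iota_q=z_E$, $s_q^V\iota_q=(\iota_q\times\iota_q)s_E$, $l_q^V\,T\iota_q=\iota_ql_E$. The Finsler bundle $\mathbf q^F\colon Fq\to E$ is given by the tangent pullback $Fq$ of $q$ along $p_M$, with projections $q^F\colon Fq\to E$ and $T^Fq\colon Fq\to TM$, its zero $z_q^F$, sum $s_q^F$, lift $l_q^F$ determined by $z_q^Fq^F=\mathrm{id}_E$, $z_q^F\,T^Fq=qz_M$; $s_q^Fq^F=\pi_1q^F$, $s_q^F\,T^Fq=(T^Fq\times T^Fq)s_M$; $l_q^F\,Tq^F=q^Fz_E$, $l_q^F\,T(T^Fq)=T^Fq\,l_M$. The horizontal descent $\pi_q\colon TE\to Fq$ is the unique morphism with $\pi_qq^F=p_E$ and $\pi_q\,T^Fq=Tq$. The square $\iota_q\pi_q=q^Vz_q^F$ (with corners $\mathbf q^V,\mathbf p_E,\mathbf 0_E,\mathbf q^F$) is commutative in $\mathsf{DB}(E)$; $q$ is a submersion if it is a pushout in $\mathsf{DB}(E)$. A horizontal connection on $q$ is $H\colon Fq\to TE$ with $H\pi_q=\mathrm{id}_{Fq}$ and $H\colon\mathbf q^F\to\mathbf p_E$ linear over $E$ ($Hp_E=q^F$, $Hl_E=l_q^F\,TH$). A horizontal connection form on $q$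 is a morphism $\psi\colon TE\to TE$ such that $\psi\pi_q=\pi_q$; $\psi\colon\mathbf p_E\to\mathbf p_E$ is linear over $E$ ($\psi p_E=p_E$, $\psi l_E=l_E\,T\psi$); and $\iota_q\psi=q^Vz_E$. *)

theory Defs
  imports Main
begin

section \<open>Categories, pullbacks and pushouts\<close>

text \<open>Composition is diagrammatic: \<open>f \<cdot> g\<close> is \<open>f\<close> followed by \<open>g\<close>.\<close>

record ('o, 'a) cat =
  Obj :: "'o set"
  Arr :: "'a set"
  Dom :: "'a \<Rightarrow> 'o"
  Cod :: "'a \<Rightarrow> 'o"
  Id :: "'o \<Rightarrow> 'a"
  Comp :: "'a \<Rightarrow> 'a \<Rightarrow> 'a" (infixl \<open>\<cdot>\<index>\<close> 70)

definition hom :: "('o, 'a, 'm) cat_scheme \<Rightarrow> 'o \<Rightarrow> 'o \<Rightarrow> 'a set" where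
  "hom C A B = {f \<in> Arr C. Dom C f = A \<and> Cod C f = B}"

locale category =
  fixes C :: "('o, 'a, 'm) cat_scheme" (structure)
  assumes dom_obj: "f \<in> Arr C \<Longrightarrow> Dom C f \<in> Obj C"
    and cod_obj: "f \<in> Arr C \<Longrightarrow> Cod C f \<in> Obj C"
    and id_hom: "A \<in> Obj C \<Longrightarrow> Id C A \<in> hom C A A"
    and comp_hom: "f \<in> hom C A B \<Longrightarrow> g \<in> hom C B D \<Longrightarrow> f \<cdot> g \<in> hom C A D"
    and id_left: "f \<in> hom C A B \<Longrightarrow> Id C A \<cdot> f = f"
    and id_right: "f \<in> hom C A B \<Longrightarrow> f \<cdot> Id C B = f"
    and comp_assoc: "f \<in> hom C A B \<Longrightarrow> g \<in> hom C B D \<Longrightarrow> h \<in> hom C D K \<Longrightarrow>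
      (f \<cdot> g) \<cdot> h = f \<cdot> (g \<cdot> h)"

context
  fixes C :: "('o, 'a, 'm) cat_scheme" (structure)
begin

text \<open>\<open>is_pullback C a b f g\<close>: the commutative square \<open>a \<cdot> f = b \<cdot> g\<close> is a pullback of the
  cospan \<open>(f, g)\<close>.\<close>

definition is_pullback :: "'a \<Rightarrow> 'a \<Rightarrow> 'a \<Rightarrow> 'a \<Rightarrow> bool" where
  "is_pullback a b f g \<longleftrightarrow>
     f \<in> Arr C \<and> g \<in> Arr C \<and> Cod C f = Cod C g \<and>
     a \<in> Arr C \<and> b \<in> Arr C \<and> Dom C a = Dom C b \<and> Cod C a = Dom C f \<and> Cod C b = Dom C g \<and>
     a \<cdot> f = b \<cdot> g \<and>
     (\<forall>N x y. x \<in> hom C N (Dom C f) \<and> y \<in> hom C N (Dom C g) \<and> x \<cdot> f = y \<cdot> g \<longrightarrow>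
        (\<exists>!u. u \<in> hom C N (Dom C a) \<and> u \<cdot> a = x \<and> u \<cdot> b = y))"

text \<open>The pairing \<open>\<langle>x, y\<rangle>\<close> into a pullback whose projections are \<open>a\<close> and \<open>b\<close>.\<close>

definition pair :: "'a \<Rightarrow> 'a \<Rightarrow> 'a \<Rightarrow> 'a \<Rightarrow> 'a" where
  "pair a b x y = (THE u. u \<in> hom C (Dom C x) (Dom C a) \<and> u \<cdot> a = x \<and> u \<cdot> b = y)"

text \<open>\<open>is_fibre_power C n q b r\<close>: the object \<open>Dom b\<close>, with projections \<open>r 0, \<dots>, r (n - 1)\<close> and
  with \<open>b\<close> as the map to \<open>Cod q\<close>, is an \<open>n\<close>-fold pullback of \<open>q\<close> along itself. The map \<open>b\<close> is
  part of the data so that the case \<open>n = 0\<close> comes out as \<open>Cod q\<close>.\<close>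

definition is_fibre_power :: "nat \<Rightarrow> 'a \<Rightarrow> 'a \<Rightarrow> (nat \<Rightarrow> 'a) \<Rightarrow> bool" where
  "is_fibre_power n q b r \<longleftrightarrow>
     q \<in> Arr C \<and> b \<in> Arr C \<and> Cod C b = Cod C q \<and>
     (\<forall>i<n. r i \<in> hom C (Dom C b) (Dom C q) \<and> r i \<cdot> q = b) \<and>
     (\<forall>N x f. x \<in> hom C N (Cod C q) \<and> (\<forall>i<n. f i \<in> hom C N (Dom C q) \<and> f i \<cdot> q = x) \<longrightarrow>
        (\<exists>!u. u \<in> hom C N (Dom C b) \<and> u \<cdot> b = x \<and> (\<forall>i<n. u \<cdot> r i = f i)))"

text \<open>\<open>is_pushout C f g i j\<close>: the commutative square \<open>f \<cdot> i = g \<cdot> j\<close> is a pushout of the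
  span \<open>(f, g)\<close>.\<close>

definition is_pushout :: "'a \<Rightarrow> 'a \<Rightarrow> 'a \<Rightarrow> 'a \<Rightarrow> bool" where
  "is_pushout f g i j \<longleftrightarrow>
     f \<in> Arr C \<and> g \<in> Arr C \<and> Dom C f = Dom C g \<and>
     i \<in> Arr C \<and> j \<in> Arr C \<and> Cod C i = Cod C j \<and> Dom C i = Cod C f \<and> Dom C j = Cod C g \<and>
     f \<cdot> i = g \<cdot> j \<and>
     (\<forall>N x y. x \<in> hom C (Cod C f) N \<and> y \<in> hom C (Cod C g) N \<and> f \<cdot> x = g \<cdot> y \<longrightarrow>
        (\<exists>!u. u \<in> hom C (Cod C i) N \<and> i \<cdot> u = x \<and> j \<cdot> u = y))"

end

section \<open>Additive bundles\<close>

text \<open>A bundle \<open>q : E \<rightarrow> M\<close> with its zero, its sum, and the projections of the pullback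
  \<open>E\<^sub>2\<close> on which the sum is defined.\<close>

record 'a add_bundle =
  bproj :: 'a
  bzero :: 'a
  bsum :: 'a
  bpr1 :: 'a
  bpr2 :: 'a

definition total_obj :: "('o, 'a, 'm) cat_scheme \<Rightarrow> ('a, 'b) add_bundle_scheme \<Rightarrow> 'o" where
  "total_obj C B = Dom C (bproj B)"

definition base_obj :: "('o, 'a, 'm) cat_scheme \<Rightarrow> ('a, 'b) add_bundle_scheme \<Rightarrow> 'o" where
  "base_obj C B = Cod C (bproj B)"

definition bpair ::
  "('o, 'a, 'm) cat_scheme \<Rightarrow> ('a, 'b) add_bundle_scheme \<Rightarrow> 'a \<Rightarrow> 'a \<Rightarrow> 'a" where
  "bpair C B x y = pair C (bpr1 B) (bpr2 B) x y"

context
  fixes C :: "('o, 'a, 'm) cat_scheme" (structure)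
begin

definition additive_bundle :: "('a, 'b) add_bundle_scheme \<Rightarrow> bool" where
  "additive_bundle B \<longleftrightarrow>
     is_pullback C (bpr1 B) (bpr2 B) (bproj B) (bproj B) \<and>
     (\<forall>n. \<exists>b r. is_fibre_power C n (bproj B) b r) \<and>
     bzero B \<in> hom C (base_obj C B) (total_obj C B) \<and>
     bzero B \<cdot> bproj B = Id C (base_obj C B) \<and>
     bsum B \<in> hom C (Dom C (bpr1 B)) (total_obj C B) \<and>
     bsum B \<cdot> bproj B = bpr1 B \<cdot> bproj B \<and>
     bpair C B (bproj B \<cdot> bzero B) (Id C (total_obj C B)) \<cdot> bsum B = Id C (total_obj C B) \<and>
     bpair C B (Id C (total_obj C B)) (bproj B \<cdot> bzero B) \<cdot> bsum B = Id C (total_obj C B) \<and>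
     bpair C B (bpr2 B) (bpr1 B) \<cdot> bsum B = bsum B \<and>
     (\<forall>b r. is_fibre_power C 3 (bproj B) b r \<longrightarrow>
        bpair C B (bpair C B (r 0) (r 1) \<cdot> bsum B) (r 2) \<cdot> bsum B =
        bpair C B (r 0) (bpair C B (r 1) (r 2) \<cdot> bsum B) \<cdot> bsum B)"

text \<open>\<open>(f, g)\<close> consists of a map \<open>f\<close> of bases and a map \<open>g\<close> of total objects.\<close>

definition additive_bundle_morphism ::
  "'a \<Rightarrow> 'a \<Rightarrow> ('a, 'b) add_bundle_scheme \<Rightarrow> ('a, 'c) add_bundle_scheme \<Rightarrow> bool" where
  "additive_bundle_morphism f g B B' \<longleftrightarrow>
     f \<in> hom C (base_obj C B) (base_obj C B') \<and> g \<in> hom C (total_obj C B) (total_obj C B') \<and>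
     bproj B \<cdot> f = g \<cdot> bproj B' \<and>
     bzero B \<cdot> g = f \<cdot> bzero B' \<and>
     bsum B \<cdot> g = bpair C B' (bpr1 B \<cdot> g) (bpr2 B \<cdot> g) \<cdot> bsum B'"

end

section \<open>Tangent categories\<close>

text \<open>\<open>T\<^sub>2 M\<close> is the common domain of the chosen projections \<open>Tpr1 M\<close> and \<open>Tpr2 M\<close>.\<close>

record ('o, 'a) tangent_cat = "('o, 'a) cat" +
  Tob :: "'o \<Rightarrow> 'o"
  Tar :: "'a \<Rightarrow> 'a"
  Tproj :: "'o \<Rightarrow> 'a"
  Tzero :: "'o \<Rightarrow> 'a"
  Tsum :: "'o \<Rightarrow> 'a"
  Tlift :: "'o \<Rightarrow> 'a"
  Tflip :: "'o \<Rightarrow> 'a"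
  Tpr1 :: "'o \<Rightarrow> 'a"
  Tpr2 :: "'o \<Rightarrow> 'a"

record 'a diff_bundle = "'a add_bundle" +
  blift :: 'a

context
  fixes X :: "('o, 'a, 'm) tangent_cat_scheme" (structure)
begin

definition is_tangent_pullback :: "'a \<Rightarrow> 'a \<Rightarrow> 'a \<Rightarrow> 'a \<Rightarrow> bool" where
  "is_tangent_pullback a b f g \<longleftrightarrow>
     (\<forall>m. is_pullback X ((Tar X ^^ m) a) ((Tar X ^^ m) b) ((Tar X ^^ m) f) ((Tar X ^^ m) g))"

definition has_tangent_fibre_powers :: "'a \<Rightarrow> bool" where
  "has_tangent_fibre_powers q \<longleftrightarrow>
     (\<forall>n. \<exists>b r. \<forall>m.
        is_fibre_power X n ((Tar X ^^ m) q) ((Tar X ^^ m) b) (\<lambda>i. (Tar X ^^ m) (r i)))"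

definition tangent_bundle :: "'o \<Rightarrow> 'a diff_bundle" where
  "tangent_bundle M = \<lparr>bproj = Tproj X M, bzero = Tzero X M, bsum = Tsum X M,
     bpr1 = Tpr1 X M, bpr2 = Tpr2 X M, blift = Tlift X M\<rparr>"

definition T_bundle :: "('a, 'b) add_bundle_scheme \<Rightarrow> 'a add_bundle" where
  "T_bundle B = \<lparr>bproj = Tar X (bproj B), bzero = Tar X (bzero B), bsum = Tar X (bsum B),
     bpr1 = Tar X (bpr1 B), bpr2 = Tar X (bpr2 B)\<rparr>"

text \<open>\<open>\<xi>\<^sub>q = \<langle>\<pi>\<^sub>1 l\<^sub>q, \<pi>\<^sub>2 z\<^sub>E\<rangle> T s\<^sub>q\<close>, where the pairing is into \<open>T E\<^sub>2\<close>.\<close>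

definition xi :: "('a, 'b) diff_bundle_scheme \<Rightarrow> 'a" where
  "xi B = bpair X (T_bundle B) (bpr1 B \<cdot> blift B) (bpr2 B \<cdot> Tzero X (total_obj X B)) \<cdot> Tar X (bsum B)"

definition universal_lift :: "('a, 'b) diff_bundle_scheme \<Rightarrow> bool" where
  "universal_lift B \<longleftrightarrow>
     is_tangent_pullback (xi B) (bpr1 B \<cdot> bproj B) (Tar X (bproj B)) (Tzero X (base_obj X B))"

end

locale tangent_category = category X
  for X :: "('o, 'a, 'm) tangent_cat_scheme" (structure) +
  assumes T_obj: "M \<in> Obj X \<Longrightarrow> Tob X M \<in> Obj X"
    and T_hom: "f \<in> hom X M N \<Longrightarrow> Tar X f \<in> hom X (Tob X M) (Tob X N)"
    and T_id: "M \<in> Obj X \<Longrightarrow> Tar X (Id X M) = Id X (Tob X M)"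
    and T_comp: "f \<in> hom X M N \<Longrightarrow> g \<in> hom X N K \<Longrightarrow> Tar X (f \<cdot> g) = Tar X f \<cdot> Tar X g"
    and p_hom: "M \<in> Obj X \<Longrightarrow> Tproj X M \<in> hom X (Tob X M) M"
    and z_hom: "M \<in> Obj X \<Longrightarrow> Tzero X M \<in> hom X M (Tob X M)"
    and l_hom: "M \<in> Obj X \<Longrightarrow> Tlift X M \<in> hom X (Tob X M) (Tob X (Tob X M))"
    and c_hom: "M \<in> Obj X \<Longrightarrow> Tflip X M \<in> hom X (Tob X (Tob X M)) (Tob X (Tob X M))"
    and T2_pullback: "M \<in> Obj X \<Longrightarrow> is_tangent_pullback X (Tpr1 X M) (Tpr2 X M) (Tproj X M) (Tproj X M)"
    and Tn_pullback: "M \<in> Obj X \<Longrightarrow> has_tangent_fibre_powers X (Tproj X M)"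
    and s_hom: "M \<in> Obj X \<Longrightarrow> Tsum X M \<in> hom X (Dom X (Tpr1 X M)) (Tob X M)"
    and p_natural: "f \<in> hom X M N \<Longrightarrow> Tproj X M \<cdot> f = Tar X f \<cdot> Tproj X N"
    and z_natural: "f \<in> hom X M N \<Longrightarrow> Tzero X M \<cdot> Tar X f = f \<cdot> Tzero X N"
    and s_natural: "f \<in> hom X M N \<Longrightarrow> Tsum X M \<cdot> Tar X f =
      pair X (Tpr1 X N) (Tpr2 X N) (Tpr1 X M \<cdot> Tar X f) (Tpr2 X M \<cdot> Tar X f) \<cdot> Tsum X N"
    and l_natural: "f \<in> hom X M N \<Longrightarrow> Tlift X M \<cdot> Tar X (Tar X f) = Tar X f \<cdot> Tlift X N"
    and c_natural: "f \<in> hom X M N \<Longrightarrow> Tflip X M \<cdot> Tar X (Tar X f) = Tar X (Tar X f) \<cdot> Tflip X N"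
    and p_additive: "M \<in> Obj X \<Longrightarrow> additive_bundle X (tangent_bundle X M)"
    and l_additive: "M \<in> Obj X \<Longrightarrow>
      additive_bundle_morphism X (Tzero X M) (Tlift X M) (tangent_bundle X M) (T_bundle X (tangent_bundle X M))"
    and c_additive: "M \<in> Obj X \<Longrightarrow>
      additive_bundle_morphism X (Id X (Tob X M)) (Tflip X M)
        (T_bundle X (tangent_bundle X M)) (tangent_bundle X (Tob X M))"
    and c_c: "M \<in> Obj X \<Longrightarrow> Tflip X M \<cdot> Tflip X M = Id X (Tob X (Tob X M))"
    and l_c: "M \<in> Obj X \<Longrightarrow> Tlift X M \<cdot> Tflip X M = Tlift X M"
    and l_l: "M \<in> Obj X \<Longrightarrow> Tlift X M \<cdot> Tar X (Tlift X M) = Tlift X M \<cdot> Tlift X (Tob X M)"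
    and c_braid: "M \<in> Obj X \<Longrightarrow>
      Tar X (Tflip X M) \<cdot> Tflip X (Tob X M) \<cdot> Tar X (Tflip X M) =
      Tflip X (Tob X M) \<cdot> Tar X (Tflip X M) \<cdot> Tflip X (Tob X M)"
    and l_T_c: "M \<in> Obj X \<Longrightarrow>
      Tlift X (Tob X M) \<cdot> Tar X (Tflip X M) \<cdot> Tflip X (Tob X M) = Tflip X M \<cdot> Tar X (Tlift X M)"
    and l_universal: "M \<in> Obj X \<Longrightarrow> universal_lift X (tangent_bundle X M)"

section \<open>Differential bundles\<close>

context
  fixes X :: "('o, 'a, 'm) tangent_cat_scheme" (structure)
begin

definition tangent_display :: "'a \<Rightarrow> bool" where
  "tangent_display q \<longleftrightarrow>
     q \<in> Arr X \<and>
     (\<forall>n N f. f \<in> hom X N ((Tob X ^^ n) (Cod X q)) \<longrightarrow>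
        (\<exists>a b. is_tangent_pullback X a b ((Tar X ^^ n) q) f))"

text \<open>Following the usual convention, differential bundles are display.\<close>

definition differential_bundle :: "('a, 'b) diff_bundle_scheme \<Rightarrow> bool" where
  "differential_bundle B \<longleftrightarrow>
     tangent_display (bproj B) \<and>
     is_tangent_pullback X (bpr1 B) (bpr2 B) (bproj B) (bproj B) \<and>
     has_tangent_fibre_powers X (bproj B) \<and>
     additive_bundle X B \<and>
     additive_bundle_morphism X (Tzero X (base_obj X B)) (blift B) B (T_bundle X B) \<and>
     additive_bundle_morphism X (bzero B) (blift B) B (tangent_bundle X (total_obj X B)) \<and>
     blift B \<cdot> Tlift X (total_obj X B) = blift B \<cdot> Tar X (blift B) \<and>
     universal_lift X B"

definition linear_over ::
  "('a, 'b) diff_bundle_scheme \<Rightarrow> 'a \<Rightarrow> ('a, 'd) diff_bundle_scheme \<Rightarrow> bool" where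
  "linear_over B g B' \<longleftrightarrow>
     base_obj X B = base_obj X B' \<and> g \<in> hom X (total_obj X B) (total_obj X B') \<and>
     g \<cdot> bproj B' = bproj B \<and> g \<cdot> blift B' = blift B \<cdot> Tar X g"

text \<open>The category \<open>DB(E)\<close>; an arrow carries its source and target bundles.\<close>

definition DB :: "'o \<Rightarrow> ('a diff_bundle, 'a diff_bundle \<times> 'a \<times> 'a diff_bundle) cat" where
  "DB E = \<lparr>Obj = {B. differential_bundle B \<and> base_obj X B = E},
     Arr = {(B, g, B'). differential_bundle B \<and> base_obj X B = E \<and>
                        differential_bundle B' \<and> base_obj X B' = E \<and> linear_over B g B'},
     Dom = (\<lambda>(B, g, B'). B),
     Cod = (\<lambda>(B, g, B'). B'),
     Id = (\<lambda>B. (B, Id X (total_obj X B), B)),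
     Comp = (\<lambda>(B, g, _) (_, g', B'). (B, g \<cdot> g', B'))\<rparr>"

definition trivial_bundle :: "'o \<Rightarrow> 'a diff_bundle" where
  "trivial_bundle E = \<lparr>bproj = Id X E, bzero = Id X E, bsum = Id X E,
     bpr1 = Id X E, bpr2 = Id X E, blift = Tzero X E\<rparr>"

section \<open>Vertical and Finsler bundles, submersions\<close>

text \<open>Pullbacks are determined only up to isomorphism, so the vertical and Finsler bundles of
  \<open>q\<close> are relations rather than functions of \<open>q\<close>. \<open>is_vertical_bundle q \<iota> tV V\<close>: \<open>V\<close> is
  the vertical bundle formed from the pullback with projections \<open>\<iota> : Vq \<rightarrow> TE\<close> and
  \<open>tV = T\<^sup>V q : Vq \<rightarrow> M\<close>.\<close>

definition is_vertical_bundle :: "'a \<Rightarrow> 'a \<Rightarrow> 'a \<Rightarrow> 'a diff_bundle \<Rightarrow> bool" where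
  "is_vertical_bundle q \<iota> tV V \<longleftrightarrow>
     (let E = Dom X q; M = Cod X q in
     is_tangent_pullback X \<iota> tV (Tar X q) (Tzero X M) \<and>
     bproj V = \<iota> \<cdot> Tproj X E \<and>
     bzero V \<in> hom X E (Dom X \<iota>) \<and> bzero V \<cdot> \<iota> = Tzero X E \<and>
     is_pullback X (bpr1 V) (bpr2 V) (bproj V) (bproj V) \<and>
     bsum V \<in> hom X (Dom X (bpr1 V)) (Dom X \<iota>) \<and>
     bsum V \<cdot> \<iota> = bpair X (tangent_bundle X E) (bpr1 V \<cdot> \<iota>) (bpr2 V \<cdot> \<iota>) \<cdot> Tsum X E \<and>
     blift V \<in> hom X (Dom X \<iota>) (Tob X (Dom X \<iota>)) \<and> blift V \<cdot> Tar X \<iota> = \<iota> \<cdot> Tlift X E)"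

text \<open>\<open>is_finsler_bundle q tF F\<close>: \<open>F\<close> is the Finsler bundle formed from the pullback with
  projections \<open>bproj F = q\<^sup>F : Fq \<rightarrow> E\<close> and \<open>tF = T\<^sup>F q : Fq \<rightarrow> TM\<close>.\<close>

definition is_finsler_bundle :: "'a \<Rightarrow> 'a \<Rightarrow> 'a diff_bundle \<Rightarrow> bool" where
  "is_finsler_bundle q tF F \<longleftrightarrow>
     (let E = Dom X q; M = Cod X q in
     is_tangent_pullback X (bproj F) tF q (Tproj X M) \<and>
     bzero F \<in> hom X E (Dom X tF) \<and>
     bzero F \<cdot> bproj F = Id X E \<and> bzero F \<cdot> tF = q \<cdot> Tzero X M \<and>
     is_pullback X (bpr1 F) (bpr2 F) (bproj F) (bproj F) \<and>
     bsum F \<in> hom X (Dom X (bpr1 F)) (Dom X tF) \<and>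
     bsum F \<cdot> bproj F = bpr1 F \<cdot> bproj F \<and>
     bsum F \<cdot> tF = bpair X (tangent_bundle X M) (bpr1 F \<cdot> tF) (bpr2 F \<cdot> tF) \<cdot> Tsum X M \<and>
     blift F \<in> hom X (Dom X tF) (Tob X (Dom X tF)) \<and>
     blift F \<cdot> Tar X (bproj F) = bproj F \<cdot> Tzero X E \<and> blift F \<cdot> Tar X tF = tF \<cdot> Tlift X M)"

definition horizontal_descent :: "'a \<Rightarrow> 'a \<Rightarrow> 'a diff_bundle \<Rightarrow> 'a" where
  "horizontal_descent q tF F = pair X (bproj F) tF (Tproj X (Dom X q)) (Tar X q)"

text \<open>A pushout in \<open>DB(E)\<close> is in particular a commutative square in \<open>DB(E)\<close>, so its four corners,
  among them the tangent bundle of \<open>E\<close>, are (display) differential bundles. The arguments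
  \<open>\<iota>\<close>, \<open>V\<close>, \<open>tF\<close>, \<open>F\<close> are meant to present the vertical and Finsler bundles of \<open>q\<close>.\<close>

definition submersion :: "'a \<Rightarrow> 'a \<Rightarrow> 'a diff_bundle \<Rightarrow> 'a \<Rightarrow> 'a diff_bundle \<Rightarrow> bool" where
  "submersion q \<iota> V tF F \<longleftrightarrow>
     (let E = Dom X q; P = tangent_bundle X E; O\<^sub>E = trivial_bundle E in
     tangent_display q \<and>
     is_pushout (DB E) (V, \<iota>, P) (V, bproj V, O\<^sub>E)
       (P, horizontal_descent q tF F, F) (O\<^sub>E, bzero F, F))"

section \<open>Horizontal connections and horizontal connection forms\<close>

definition horizontal_connection :: "'a \<Rightarrow> 'a \<Rightarrow> 'a diff_bundle \<Rightarrow> 'a \<Rightarrow> bool" where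
  "horizontal_connection q tF F H \<longleftrightarrow>
     H \<in> hom X (total_obj X F) (Tob X (Dom X q)) \<and>
     H \<cdot> horizontal_descent q tF F = Id X (total_obj X F) \<and>
     linear_over F H (tangent_bundle X (Dom X q))"

definition horizontal_connection_form ::
  "'a \<Rightarrow> 'a \<Rightarrow> 'a diff_bundle \<Rightarrow> 'a \<Rightarrow> 'a diff_bundle \<Rightarrow> 'a \<Rightarrow> bool" where
  "horizontal_connection_form q \<iota> V tF F \<psi> \<longleftrightarrow>
     (let E = Dom X q in
     \<psi> \<in> hom X (Tob X E) (Tob X E) \<and>
     \<psi> \<cdot> horizontal_descent q tF F = horizontal_descent q tF F \<and>
     linear_over (tangent_bundle X E) \<psi> (tangent_bundle X E) \<and>
     \<iota> \<cdot> \<psi> = bproj V \<cdot> Tzero X E)"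

text \<open>\<open>H\<^sub>\<psi>\<close>; meaningful only when such a morphism exists uniquely.\<close>

definition connection_of_form :: "'a \<Rightarrow> 'a \<Rightarrow> 'a diff_bundle \<Rightarrow> 'a \<Rightarrow> 'a" where
  "connection_of_form q tF F \<psi> =
     (let E = Dom X q; P = tangent_bundle X E in
     THE H. (F, H, P) \<in> hom (DB E) F P \<and>
       horizontal_descent q tF F \<cdot> H = \<psi> \<and> bzero F \<cdot> H = Tzero X E)"

definition form_of_connection :: "'a \<Rightarrow> 'a \<Rightarrow> 'a diff_bundle \<Rightarrow> 'a \<Rightarrow> 'a" where
  "form_of_connection q tF F H = horizontal_descent q tF F \<cdot> H"

end

end

theory Submission
  imports Defs
begin

text \<open>
  Linear morphisms automatically preserve zeros: on a differential bundle the lift followed by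
  the projection of the tangent bundle of the total space is \<open>q \<cdot> z\<^sub>q\<close>, and lifting a zero
  vector only inserts a zero tangent vector, so the image of the zero section under a linear
  morphism is again the zero section. Hence the zero section is the only linear morphism
  out of the trivial bundle, and the pushout that defines a submersion says that the horizontal
  descent \<open>\<pi>\<^sub>q\<close> is a cokernel of \<open>\<iota>\<^sub>q\<close> in \<open>DB(E)\<close>: every linear morphism out of \<open>p\<^sub>E\<close> that is
  zero on vertical vectors factors uniquely through \<open>\<pi>\<^sub>q\<close>.

  A horizontal connection is a linear section \<open>H\<close> of \<open>\<pi>\<^sub>q\<close>. The composite \<open>\<pi>\<^sub>q \<cdot> H\<close> is then
  linear, compatible with \<open>\<pi>\<^sub>q\<close>, and zero on vertical vectors because \<open>\<pi>\<^sub>q\<close> is. Conversely a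
  connection form is zero on vertical vectors, so it factors as \<open>\<psi> = \<pi>\<^sub>q \<cdot> H\<close> with \<open>H\<close> linear;
  from \<open>\<pi>\<^sub>q \<cdot> H \<cdot> \<pi>\<^sub>q = \<psi> \<cdot> \<pi>\<^sub>q = \<pi>\<^sub>q\<close> and the uniqueness of factorizations through \<open>\<pi>\<^sub>q\<close>, \<open>H\<close> is a
  section. Uniqueness also makes the two passages mutually inverse.
\<close>

lemma hom_dom_cod:
  "f \<in> hom C A B \<Longrightarrow> Dom C f = A" "f \<in> hom C A B \<Longrightarrow> Cod C f = B" "f \<in> hom C A B \<Longrightarrow> f \<in> Arr C"
  by (auto simp: hom_def)

lemma tangent_bundle_simps [simp]:
  "bproj (tangent_bundle X M) = Tproj X M"
  "bzero (tangent_bundle X M) = Tzero X M"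
  "blift (tangent_bundle X M) = Tlift X M"
  by (simp_all add: tangent_bundle_def)

lemma hom_DB_iff:
  "(B, g, B') \<in> hom (DB X E) B B' \<longleftrightarrow>
     differential_bundle X B \<and> base_obj X B = E \<and>
     differential_bundle X B' \<and> base_obj X B' = E \<and> linear_over X B g B'"
  by (auto simp: hom_def DB_def)

context tangent_category
begin

lemma tangent_bundle_objs:
  assumes "E \<in> Obj X"
  shows "total_obj X (tangent_bundle X E) = Tob X E" "base_obj X (tangent_bundle X E) = E"
  using p_hom[OF assms] by (simp_all add: total_obj_def base_obj_def hom_def)

lemma differential_bundle_structure:
  assumes "differential_bundle X B"
  shows "base_obj X B \<in> Obj X" "total_obj X B \<in> Obj X"
    and "bproj B \<in> hom X (total_obj X B) (base_obj X B)"
    and "bzero B \<in> hom X (base_obj X B) (total_obj X B)"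
    and "blift B \<in> hom X (total_obj X B) (Tob X (total_obj X B))"
    and "bzero B \<cdot> bproj B = Id X (base_obj X B)"
proof -
  have add: "additive_bundle X B"
    and l: "additive_bundle_morphism X (Tzero X (base_obj X B)) (blift B) B (T_bundle X B)"
    and "tangent_display X (bproj B)"
    using assms by (auto simp: differential_bundle_def)
  then show p: "bproj B \<in> hom X (total_obj X B) (base_obj X B)"
    by (auto simp: tangent_display_def hom_def total_obj_def base_obj_def)
  then show "base_obj X B \<in> Obj X" "total_obj X B \<in> Obj X"
    using dom_obj cod_obj by (metis hom_dom_cod)+
  show "bzero B \<in> hom X (base_obj X B) (total_obj X B)" "bzero B \<cdot> bproj B = Id X (base_obj X B)"
    using add by (auto simp: additive_bundle_def)
  show "blift B \<in> hom X (total_obj X B) (Tob X (total_obj X B))"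
    using l T_hom[OF p]
    by (auto simp: additive_bundle_morphism_def T_bundle_def total_obj_def hom_def)
qed

lemma differential_bundle_lift:
  assumes "differential_bundle X B"
  shows "bzero B \<cdot> blift B = bzero B \<cdot> Tzero X (total_obj X B)"
    and "bzero B \<cdot> blift B = Tzero X (base_obj X B) \<cdot> Tar X (bzero B)"
    and "blift B \<cdot> Tproj X (total_obj X B) = bproj B \<cdot> bzero B"
  using assms
  by (auto simp: differential_bundle_def additive_bundle_morphism_def T_bundle_def)

lemma zero_then_proj:
  assumes "A \<in> Obj X"
  shows "Tzero X A \<cdot> Tproj X A = Id X A"
  using p_additive[OF assms] tangent_bundle_objs[OF assms] by (auto simp: additive_bundle_def)

lemma linear_over_comp:
  assumes "differential_bundle X B" "differential_bundle X B'" "differential_bundle X B''"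
    and "linear_over X B g B'" "linear_over X B' h B''"
  shows "linear_over X B (g \<cdot> h) B''"
proof -
  note st = differential_bundle_structure
  have g: "g \<in> hom X (total_obj X B) (total_obj X B')" "g \<cdot> bproj B' = bproj B"
      "g \<cdot> blift B' = blift B \<cdot> Tar X g"
    and h: "h \<in> hom X (total_obj X B') (total_obj X B'')" "h \<cdot> bproj B'' = bproj B'"
      "h \<cdot> blift B'' = blift B' \<cdot> Tar X h"
    and base: "base_obj X B = base_obj X B'" "base_obj X B' = base_obj X B''"
    using assms(4,5) by (auto simp: linear_over_def)
  have "g \<cdot> h \<cdot> bproj B'' = bproj B"
    using comp_assoc[OF g(1) h(1) st(3)[OF assms(3)]] g(2) h(2) by simp
  moreover have "g \<cdot> h \<cdot> blift B'' = blift B \<cdot> Tar X (g \<cdot> h)"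
  proof -
    have "g \<cdot> h \<cdot> blift B'' = g \<cdot> (blift B' \<cdot> Tar X h)"
      using comp_assoc[OF g(1) h(1) st(5)[OF assms(3)]] h(3) by simp
    also have "\<dots> = blift B \<cdot> Tar X g \<cdot> Tar X h"
      using comp_assoc[OF g(1) st(5)[OF assms(2)] T_hom[OF h(1)]] g(3) by simp
    also have "\<dots> = blift B \<cdot> Tar X (g \<cdot> h)"
      using comp_assoc[OF st(5)[OF assms(1)] T_hom[OF g(1)] T_hom[OF h(1)]] T_comp[OF g(1) h(1)]
      by simp
    finally show ?thesis .
  qed
  ultimately show ?thesis
    using comp_hom[OF g(1) h(1)] base by (simp add: linear_over_def)
qed

lemma linear_over_Id:
  assumes "differential_bundle X B"
  shows "linear_over X B (Id X (total_obj X B)) B"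
  using differential_bundle_structure[OF assms] id_hom id_left id_right T_id
  by (auto simp: linear_over_def)

text \<open>
  Put \<open>u = z\<^sub>B \<cdot> g\<close>. Since the lift of a zero is a zero tangent vector, linearity of \<open>g\<close> gives
  \<open>u \<cdot> l\<^sub>B\<^sub>' = u \<cdot> z\<^sub>E\<^sub>'\<close>, where \<open>E'\<close> is the total space of \<open>B'\<close>. Projecting back to \<open>E'\<close> turns the
  right side into \<open>u\<close> and the left side into \<open>u \<cdot> q' \<cdot> z\<^sub>B\<^sub>'\<close>, and \<open>u\<close> is a section of \<open>q'\<close>.
\<close>

lemma linear_over_preserves_zero:
  assumes B: "differential_bundle X B" and B': "differential_bundle X B'"
    and lin: "linear_over X B g B'"
  shows "bzero B \<cdot> g = bzero B'"
proof -
  note st = differential_bundle_structure[OF B] and st' = differential_bundle_structure[OF B']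
  let ?u = "bzero B \<cdot> g" and ?A = "total_obj X B'"
  have g: "g \<in> hom X (total_obj X B) ?A" "g \<cdot> bproj B' = bproj B"
      "g \<cdot> blift B' = blift B \<cdot> Tar X g"
    and base: "base_obj X B = base_obj X B'"
    using lin by (auto simp: linear_over_def)
  have u: "?u \<in> hom X (base_obj X B) ?A"
    by (rule comp_hom[OF st(4) g(1)])
  have "?u \<cdot> blift B' = bzero B \<cdot> blift B \<cdot> Tar X g"
    using comp_assoc[OF st(4) g(1) st'(5)] comp_assoc[OF st(4) st(5) T_hom[OF g(1)]] g(3) by simp
  also have "\<dots> = bzero B \<cdot> (Tzero X (total_obj X B) \<cdot> Tar X g)"
    using comp_assoc[OF st(4) z_hom[OF st(2)] T_hom[OF g(1)]] differential_bundle_lift(1)[OF B]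
    by simp
  also have "\<dots> = ?u \<cdot> Tzero X ?A"
    using comp_assoc[OF st(4) g(1) z_hom[OF st'(2)]] z_natural[OF g(1)] by simp
  finally have lifted: "?u \<cdot> blift B' = ?u \<cdot> Tzero X ?A" .
  have "?u = ?u \<cdot> Tzero X ?A \<cdot> Tproj X ?A"
    using comp_assoc[OF u z_hom[OF st'(2)] p_hom[OF st'(2)]] zero_then_proj[OF st'(2)]
      id_right[OF u] by simp
  also have "\<dots> = ?u \<cdot> (bproj B' \<cdot> bzero B')"
    using comp_assoc[OF u st'(5) p_hom[OF st'(2)]] lifted differential_bundle_lift(3)[OF B']
    by simp
  also have "\<dots> = bzero B \<cdot> bproj B \<cdot> bzero B'"
    using comp_assoc[OF u st'(3) st'(4)] comp_assoc[OF st(4) g(1) st'(3)] g(2) by simp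
  also have "\<dots> = bzero B'"
    using st(6) base id_left[OF st'(4)] by simp
  finally show ?thesis .
qed

lemma linear_over_zero_section:
  assumes "differential_bundle X B"
  shows "linear_over X (trivial_bundle X (base_obj X B)) (bzero B) B"
proof -
  note st = differential_bundle_structure[OF assms]
  show ?thesis
    using st(4,6) differential_bundle_lift(2)[OF assms] id_hom[OF st(1)]
    by (auto simp: linear_over_def trivial_bundle_def total_obj_def base_obj_def hom_def)
qed

end

text \<open>
  The pushout square of a submersion unpacked from \<open>DB(E)\<close> into statements about morphisms of
  the tangent category itself.
\<close>

lemma submersionD:
  fixes X :: "('o, 'a, 'm) tangent_cat_scheme"
  assumes "submersion X q \<iota> V tF F" and "q \<in> hom X E M"
  shows "differential_bundle X V" "base_obj X V = E" "linear_over X V \<iota> (tangent_bundle X E)"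
    and "differential_bundle X (tangent_bundle X E)" "base_obj X (tangent_bundle X E) = E"
    and "differential_bundle X (trivial_bundle X E)" "base_obj X (trivial_bundle X E) = E"
    and "differential_bundle X F" "base_obj X F = E"
    and "linear_over X (tangent_bundle X E) (horizontal_descent X q tF F) F"
    and "\<iota> \<cdot>\<^bsub>X\<^esub> horizontal_descent X q tF F = bproj V \<cdot>\<^bsub>X\<^esub> bzero F"
    and "\<And>(N :: 'a diff_bundle) x y. differential_bundle X N \<Longrightarrow> base_obj X N = E \<Longrightarrow>
      linear_over X (tangent_bundle X E) x N \<Longrightarrow> linear_over X (trivial_bundle X E) y N \<Longrightarrow>
      \<iota> \<cdot>\<^bsub>X\<^esub> x = bproj V \<cdot>\<^bsub>X\<^esub> y \<Longrightarrow>
      \<exists>!u. linear_over X F u N \<and> horizontal_descent X q tF F \<cdot>\<^bsub>X\<^esub> u = x \<and> bzero F \<cdot>\<^bsub>X\<^esub> u = y"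
proof -
  let ?P = "tangent_bundle X E" and ?Z = "trivial_bundle X E"
  let ?h = "horizontal_descent X q tF F"
  have q: "Dom X q = E" using assms(2) by (simp add: hom_def)
  have po: "is_pushout (DB X E) (V, \<iota>, ?P) (V, bproj V, ?Z) (?P, ?h, F) (?Z, bzero F, F)"
    using assms(1) by (simp add: submersion_def Let_def q)
  show facts: "differential_bundle X V" "base_obj X V = E" "linear_over X V \<iota> ?P"
    "differential_bundle X ?P" "base_obj X ?P = E" "differential_bundle X ?Z" "base_obj X ?Z = E"
    "differential_bundle X F" "base_obj X F = E" "linear_over X ?P ?h F"
    "\<iota> \<cdot>\<^bsub>X\<^esub> ?h = bproj V \<cdot>\<^bsub>X\<^esub> bzero F"
    using po by (auto simp: is_pushout_def DB_def)
  fix N :: "'a diff_bundle" and x y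
  assume N: "differential_bundle X N" "base_obj X N = E" and x: "linear_over X ?P x N"
    and y: "linear_over X ?Z y N" and eq: "\<iota> \<cdot>\<^bsub>X\<^esub> x = bproj V \<cdot>\<^bsub>X\<^esub> y"
  have "\<forall>x y. x \<in> hom (DB X E) ?P N \<and> y \<in> hom (DB X E) ?Z N \<and>
      Comp (DB X E) (V, \<iota>, ?P) x = Comp (DB X E) (V, bproj V, ?Z) y \<longrightarrow>
      (\<exists>!u. u \<in> hom (DB X E) F N \<and> Comp (DB X E) (?P, ?h, F) u = x \<and>
        Comp (DB X E) (?Z, bzero F, F) u = y)"
    using po by (simp add: is_pushout_def DB_def)
  moreover have "(?P, x, N) \<in> hom (DB X E) ?P N" "(?Z, y, N) \<in> hom (DB X E) ?Z N"
    using facts N x y by (simp_all add: hom_DB_iff)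
  moreover have "Comp (DB X E) (V, \<iota>, ?P) (?P, x, N) = Comp (DB X E) (V, bproj V, ?Z) (?Z, y, N)"
    using eq by (simp add: DB_def)
  ultimately have "\<exists>!u. u \<in> hom (DB X E) F N \<and> Comp (DB X E) (?P, ?h, F) u = (?P, x, N) \<and>
      Comp (DB X E) (?Z, bzero F, F) u = (?Z, y, N)"
    by blast
  moreover have "u \<in> hom (DB X E) F N \<and> Comp (DB X E) (?P, ?h, F) u = (?P, x, N) \<and>
      Comp (DB X E) (?Z, bzero F, F) u = (?Z, y, N) \<longleftrightarrow>
      (\<exists>g. u = (F, g, N) \<and> linear_over X F g N \<and> ?h \<cdot>\<^bsub>X\<^esub> g = x \<and> bzero F \<cdot>\<^bsub>X\<^esub> g = y)" for u
    using facts N by (cases u) (auto simp: hom_def DB_def)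
  ultimately show "\<exists>!u. linear_over X F u N \<and> ?h \<cdot>\<^bsub>X\<^esub> u = x \<and> bzero F \<cdot>\<^bsub>X\<^esub> u = y"
    by (metis (no_types, lifting) prod.inject)
qed

text \<open>
  A linear morphism preserves zeros, and on \<open>0\<^sub>E\<close> the zero is the identity, so the leg
  \<open>0\<^sub>E \<rightarrow> N\<close> of a cocone can only be the zero section of \<open>N\<close>. The pushout square thus makes the
  horizontal descent a cokernel of \<open>\<iota>\<close>.
\<close>

lemma (in tangent_category) horizontal_descent_cokernel:
  fixes N :: "'a diff_bundle"
  assumes sub: "submersion X q \<iota> V tF F" and q: "q \<in> hom X E M"
    and N: "differential_bundle X N" "base_obj X N = E"
    and x: "linear_over X (tangent_bundle X E) x N" "\<iota> \<cdot> x = bproj V \<cdot> bzero N"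
  shows "\<exists>!u. linear_over X F u N \<and> horizontal_descent X q tF F \<cdot> u = x"
  using submersionD(12)[OF sub q N x(1) _ x(2)] linear_over_zero_section[OF N(1)] N(2)
    linear_over_preserves_zero[OF submersionD(8)[OF sub q] N(1)]
  by metis

theorem theorem3p11:
  fixes X :: "('o, 'a, 'm) tangent_cat_scheme"
    and E M :: 'o
    and q \<iota> tV tF :: 'a
    and V F :: "'a diff_bundle"
  assumes "tangent_category X"
    and "q \<in> hom X E M"
    and "is_vertical_bundle X q \<iota> tV V"
    and "is_finsler_bundle X q tF F"
    and "submersion X q \<iota> V tF F"
  shows "(\<forall>H. horizontal_connection X q tF F H \<longrightarrow>
            horizontal_connection_form X q \<iota> V tF F (form_of_connection X q tF F H))
    \<and> (\<forall>\<psi>. horizontal_connection_form X q \<iota> V tF F \<psi> \<longrightarrow>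
            (\<exists>!H. (F, H, tangent_bundle X E) \<in> hom (DB X E) F (tangent_bundle X E) \<and>
                 horizontal_descent X q tF F \<cdot>\<^bsub>X\<^esub> H = \<psi> \<and> bzero F \<cdot>\<^bsub>X\<^esub> H = Tzero X E) \<and>
            horizontal_connection X q tF F (connection_of_form X q tF F \<psi>))
    \<and> (\<forall>H. horizontal_connection X q tF F H \<longrightarrow>
            connection_of_form X q tF F (form_of_connection X q tF F H) = H)
    \<and> (\<forall>\<psi>. horizontal_connection_form X q \<iota> V tF F \<psi> \<longrightarrow>
            form_of_connection X q tF F (connection_of_form X q tF F \<psi>) = \<psi>)
    \<and> bij_betw (form_of_connection X q tF F)
        {H. horizontal_connection X q tF F H}
        {\<psi>. horizontal_connection_form X q \<iota> V tF F \<psi>}"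
proof -
  interpret tangent_category X by fact
  note q = assms(2) and sub = submersionD[OF assms(5,2)]
  let ?P = "tangent_bundle X E" and ?\<pi> = "horizontal_descent X q tF F"
  let ?conn = "horizontal_connection X q tF F" and ?form = "horizontal_connection_form X q \<iota> V tF F"
  have dom: "Dom X q = E" and E: "E \<in> Obj X"
    using q dom_obj by (auto simp: hom_def)
  note cokernel = horizontal_descent_cokernel[OF assms(5) q]
    and zero = linear_over_preserves_zero
    and P = tangent_bundle_objs[OF E]
  have homI: "f \<in> hom X (total_obj X B) (total_obj X B')" if "linear_over X B f B'"
    for f and B B' :: "'a diff_bundle"
    using that by (simp add: linear_over_def)
  have conn_iff: "?conn H \<longleftrightarrow> H \<cdot>\<^bsub>X\<^esub> ?\<pi> = Id X (total_obj X F) \<and> linear_over X F H ?P" for H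
    by (auto simp: horizontal_connection_def dom P linear_over_def)
  have form_iff: "?form \<psi> \<longleftrightarrow>
      \<psi> \<cdot>\<^bsub>X\<^esub> ?\<pi> = ?\<pi> \<and> linear_over X ?P \<psi> ?P \<and> \<iota> \<cdot>\<^bsub>X\<^esub> \<psi> = bproj V \<cdot>\<^bsub>X\<^esub> Tzero X E" for \<psi>
    by (auto simp: horizontal_connection_form_def dom P linear_over_def Let_def)
  have \<pi>: "?\<pi> \<in> hom X (total_obj X ?P) (total_obj X F)"
    by (rule homI[OF sub(10)])
  have \<iota>: "\<iota> \<in> hom X (total_obj X V) (total_obj X ?P)"
    by (rule homI[OF sub(3)])

  \<comment> \<open>Linear morphisms preserve zeros, so \<open>H\<^sub>\<psi>\<close> is the factorization of \<open>\<psi>\<close> through the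
    cokernel \<open>\<pi>\<^sub>q\<close>.\<close>
  have spec_iff: "(F, H, ?P) \<in> hom (DB X E) F ?P \<and> ?\<pi> \<cdot>\<^bsub>X\<^esub> H = \<psi> \<and> bzero F \<cdot>\<^bsub>X\<^esub> H = Tzero X E \<longleftrightarrow>
      linear_over X F H ?P \<and> ?\<pi> \<cdot>\<^bsub>X\<^esub> H = \<psi>" for H \<psi>
    using zero[OF sub(8,4)] sub(4,5,8,9) by (auto simp: hom_DB_iff)

  have form: "?form (?\<pi> \<cdot>\<^bsub>X\<^esub> H)" if "?conn H" for H
  proof -
    have sec: "H \<cdot>\<^bsub>X\<^esub> ?\<pi> = Id X (total_obj X F)" and lin: "linear_over X F H ?P"
      using that by (auto simp: conn_iff)
    note H = homI[OF lin]
    have "?\<pi> \<cdot>\<^bsub>X\<^esub> H \<cdot>\<^bsub>X\<^esub> ?\<pi> = ?\<pi>"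
      using comp_assoc[OF \<pi> H \<pi>] sec id_right[OF \<pi>] by simp
    moreover have "\<iota> \<cdot>\<^bsub>X\<^esub> (?\<pi> \<cdot>\<^bsub>X\<^esub> H) = bproj V \<cdot>\<^bsub>X\<^esub> Tzero X E"
    proof -
      have V: "bproj V \<in> hom X (total_obj X V) E" and F: "bzero F \<in> hom X E (total_obj X F)"
        using differential_bundle_structure(3)[OF sub(1)] differential_bundle_structure(4)[OF sub(8)]
          sub(2,9) by auto
      have "\<iota> \<cdot>\<^bsub>X\<^esub> (?\<pi> \<cdot>\<^bsub>X\<^esub> H) = bproj V \<cdot>\<^bsub>X\<^esub> (bzero F \<cdot>\<^bsub>X\<^esub> H)"
        using comp_assoc[OF \<iota> \<pi> H] comp_assoc[OF V F H] sub(11) by simp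
      then show ?thesis
        using zero[OF sub(8,4) lin] by simp
    qed
    ultimately show ?thesis
      using linear_over_comp[OF sub(4,8,4,10) lin] by (simp add: form_iff)
  qed

  have factor: "\<exists>!H. linear_over X F H ?P \<and> ?\<pi> \<cdot>\<^bsub>X\<^esub> H = \<psi>" if "?form \<psi>" for \<psi>
    using cokernel[OF sub(4,5)] that by (simp add: form_iff)

  have section_of_descent: "?conn H" if "linear_over X F H ?P" "?form (?\<pi> \<cdot>\<^bsub>X\<^esub> H)" for H
  proof -
    \<comment> \<open>Both \<open>H \<cdot> \<pi>\<^sub>q\<close> and the identity factor \<open>\<pi>\<^sub>q\<close> through itself.\<close>
    have "linear_over X F (H \<cdot>\<^bsub>X\<^esub> ?\<pi>) F" "linear_over X F (Id X (total_obj X F)) F"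
      using linear_over_comp[OF sub(8,4,8) that(1) sub(10)] linear_over_Id[OF sub(8)] by auto
    moreover have "?\<pi> \<cdot>\<^bsub>X\<^esub> (H \<cdot>\<^bsub>X\<^esub> ?\<pi>) = ?\<pi>" "?\<pi> \<cdot>\<^bsub>X\<^esub> Id X (total_obj X F) = ?\<pi>"
      using comp_assoc[OF \<pi> homI[OF that(1)] \<pi>] that(2) id_right[OF \<pi>] by (auto simp: form_iff)
    ultimately have "H \<cdot>\<^bsub>X\<^esub> ?\<pi> = Id X (total_obj X F)"
      using cokernel[OF sub(8,9,10,11)] by blast
    then show ?thesis
      using that(1) by (simp add: conn_iff)
  qed

  have conn_of: "connection_of_form X q tF F \<psi> = (THE H. linear_over X F H ?P \<and> ?\<pi> \<cdot>\<^bsub>X\<^esub> H = \<psi>)" for \<psi>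
    by (simp add: connection_of_form_def dom Let_def spec_iff)
  have form_of: "form_of_connection X q tF F H = ?\<pi> \<cdot>\<^bsub>X\<^esub> H" for H
    by (simp add: form_of_connection_def)
  have conn_of_spec: "linear_over X F (connection_of_form X q tF F \<psi>) ?P"
      "?\<pi> \<cdot>\<^bsub>X\<^esub> connection_of_form X q tF F \<psi> = \<psi>" if "?form \<psi>" for \<psi>
    using theI'[OF factor[OF that]] by (auto simp: conn_of)
  have conn: "?conn (connection_of_form X q tF F \<psi>)" if "?form \<psi>" for \<psi>
    using section_of_descent conn_of_spec[OF that] that by simp
  have inv: "connection_of_form X q tF F (?\<pi> \<cdot>\<^bsub>X\<^esub> H) = H" if "?conn H" for H
    using factor[OF form[OF that]] conn_of_spec[OF form[OF that]] that by (auto simp: conn_iff)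
  have "bij_betw (form_of_connection X q tF F) {H. ?conn H} {\<psi>. ?form \<psi>}"
    by (rule bij_betw_byWitness[where f' = "connection_of_form X q tF F"])
      (auto simp: form_of inv form conn conn_of_spec)
  then show ?thesis
    using form factor conn inv conn_of_spec by (simp add: form_of spec_iff)
qed

end
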